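(* For every positive integer $n$, each of the following statistics on $S_n$ is homomesic with respect to the reverse map $\mathcal{R}$ and also homomesic with respect to the complement map $\mathcal{C}$: (1) the number of inversions; (2) the inversion sum; (3) the number of non-inversions; (4) the non-inversion sum; (5) the number of inversions of distance at most $3$; (6) the number of inversions of distance at most $2$; (7) the number of even inversions; (8) the number of odd inversions; (9) the standardized bi-alternating inversion number; (10) the number of descents; (11) the number of ascents; (12) the number of runs; (13) the number of cyclic descents; (14) the number of descents of distance $2$; (15) the number of ascents of distance $2$; (16) the number of strict $3$-descents; (17) the width of the permutation tree; (18) the cosine; (19) the number of recoils; (20) the total number of occurrences of the patterns $132$, $213$ and $321$; (21) the number of descents plus the number of recoils; (22) Spearman's rho with the identity.
   Context: Homomesy: given a finite set $S$, a bijection $\mathcal{X}:S\to S$ and $f:S\to\mathbb{Z}$, $f$ is homomesic if there is a constant $c$ such that for every orbit $\mathcal{O}$ of $\mathcal{X}$, $\frac{1}{|\mathcal{O}|}\sum_{x\in\mathcal{O}}f(x)=c$. For $\sigma=\sigma_1\cdots\sigma_n\in S_n$ (one-line notation): $\mathcal{R}(\sigma)_i=\sigma_{n+1-i}$ and $\mathcal{C}(\sigma)_i=n+1-\sigma_i$. An inversion is a pair of positions $(i,j)$, $i<j$, $\sigma_i>\sigma_j$; a non-inversion is a pair $i<j$ with $\sigma_i<\sigma_j$. It has distance $j-i$; it is even if $i\equiv j\pmod 2$ and odd otherwise. The inversion sum is $\sum_{(a,b)\text{ inversion}}(b-a)$, the non-inversion sum is $\sum_{(a,b)\text{ non-inversion}}(b-a)$.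 With $j(\sigma)=\sum_{1\le y<x\le n}(-1)^{x+y}\mathrm{sign}(\sigma_x-\sigma_y)$, the standardized bi-alternating inversion number is $(j(\sigma)+\lfloor n/2\rfloor^2)/2$. A descent is $i\in[n-1]$ with $\sigma_i>\sigma_{i+1}$, an ascent otherwise. A run is a maximal contiguous increasing subsequence. The number of cyclic descents is the number of descents plus $1$ if $\sigma_n<\sigma_1$. A descent of distance $2$ is $i\in[n-2]$ with $\sigma_i>\sigma_{i+2}$ (otherwise an ascent of distance $2$); a strict $3$-descent is $i\in[n-3]$ with $\sigma_i>\sigma_{i+3}$. The permutation tree of $\sigma$ is the rooted tree on $\{0,\dots,n\}$ with root $0$ where $\sigma_1$ is a child of the root and $\sigma_{i+1}$ is attached as a child of the first node smaller than $\sigma_{i+1}$ on the path from $\sigma_i$ to the root; its width is its number of leaves. The cosine is $\sum_{i=1}^n i\sigma_i$. A recoil is a value $i\in[n-1]$ such that $i+1$ appears to the left of $i$ in $\sigma$ (equivalently a descent of $\sigma^{-1}$). An occurrence of a pattern $abc$ is a triple of positions $i_1<i_2<i_3$ with $\sigma_{i_1}\sigma_{i_2}\sigma_{i_3}$ in the same relative order as $abc$. Spearman's rho with the identity is $\sum_{i=1}^n(\sigma_i-i)^2$. *)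

theory Defs
  imports Complex_Main "HOL-Combinatorics.Permutations" "HOL-Combinatorics.Orbits"
begin

definition homomesic :: "'a set \<Rightarrow> ('a \<Rightarrow> 'a) \<Rightarrow> ('a \<Rightarrow> int) \<Rightarrow> bool" where
  "homomesic S X f \<longleftrightarrow> finite S \<and> bij_betw X S S \<and>
     (\<exists>c::real. \<forall>Orb \<in> orbit X ` S. (\<Sum>x\<in>Orb. real_of_int (f x)) / real (card Orb) = c)"

text \<open>Elements of \<open>S\<^sub>n\<close> are functions permuting \<open>{1..n}\<close> (hence the identity elsewhere);
  the one-line notation of \<open>\<sigma>\<close> is \<open>\<sigma> 1, \<dots>, \<sigma> n\<close>. Statistics take \<open>n\<close> as first argument and
  are integer-valued.\<close>

definition Sym :: "nat \<Rightarrow> (nat \<Rightarrow> nat) set" where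
  "Sym n = {\<sigma>. \<sigma> permutes {1..n}}"

definition reverse_map :: "nat \<Rightarrow> (nat \<Rightarrow> nat) \<Rightarrow> nat \<Rightarrow> nat" where
  "reverse_map n \<sigma> = (\<lambda>i. if i \<in> {1..n} then \<sigma> (n + 1 - i) else i)"

definition complement_map :: "nat \<Rightarrow> (nat \<Rightarrow> nat) \<Rightarrow> nat \<Rightarrow> nat" where
  "complement_map n \<sigma> = (\<lambda>i. if i \<in> {1..n} then n + 1 - \<sigma> i else i)"

definition inversions :: "nat \<Rightarrow> (nat \<Rightarrow> nat) \<Rightarrow> (nat \<times> nat) set" where
  "inversions n \<sigma> = {(i, j). 1 \<le> i \<and> i < j \<and> j \<le> n \<and> \<sigma> i > \<sigma> j}"

definition non_inversions :: "nat \<Rightarrow> (nat \<Rightarrow> nat) \<Rightarrow> (nat \<times> nat) set" where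
  "non_inversions n \<sigma> = {(i, j). 1 \<le> i \<and> i < j \<and> j \<le> n \<and> \<sigma> i < \<sigma> j}"

definition num_inversions :: "nat \<Rightarrow> (nat \<Rightarrow> nat) \<Rightarrow> int" where
  "num_inversions n \<sigma> = int (card (inversions n \<sigma>))"

definition inversion_sum :: "nat \<Rightarrow> (nat \<Rightarrow> nat) \<Rightarrow> int" where
  "inversion_sum n \<sigma> = (\<Sum>(a, b)\<in>inversions n \<sigma>. int b - int a)"

definition num_non_inversions :: "nat \<Rightarrow> (nat \<Rightarrow> nat) \<Rightarrow> int" where
  "num_non_inversions n \<sigma> = int (card (non_inversions n \<sigma>))"

definition non_inversion_sum :: "nat \<Rightarrow> (nat \<Rightarrow> nat) \<Rightarrow> int" where
  "non_inversion_sum n \<sigma> = (\<Sum>(a, b)\<in>non_inversions n \<sigma>. int b - int a)"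

definition num_inversions_dist_le :: "nat \<Rightarrow> nat \<Rightarrow> (nat \<Rightarrow> nat) \<Rightarrow> int" where
  "num_inversions_dist_le d n \<sigma> = int (card {(i, j) \<in> inversions n \<sigma>. j - i \<le> d})"

definition num_even_inversions :: "nat \<Rightarrow> (nat \<Rightarrow> nat) \<Rightarrow> int" where
  "num_even_inversions n \<sigma> = int (card {(i, j) \<in> inversions n \<sigma>. i mod 2 = j mod 2})"

definition num_odd_inversions :: "nat \<Rightarrow> (nat \<Rightarrow> nat) \<Rightarrow> int" where
  "num_odd_inversions n \<sigma> = int (card {(i, j) \<in> inversions n \<sigma>. i mod 2 \<noteq> j mod 2})"

definition bialternating_sum :: "nat \<Rightarrow> (nat \<Rightarrow> nat) \<Rightarrow> int" where
  "bialternating_sum n \<sigma> =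
     (\<Sum>x=1..n. \<Sum>y=1..<x. (-1) ^ (x + y) * sgn (int (\<sigma> x) - int (\<sigma> y)))"

definition std_bialternating_inversion_number :: "nat \<Rightarrow> (nat \<Rightarrow> nat) \<Rightarrow> int" where
  "std_bialternating_inversion_number n \<sigma> =
     (bialternating_sum n \<sigma> + (int (n div 2))\<^sup>2) div 2"

definition descents :: "nat \<Rightarrow> (nat \<Rightarrow> nat) \<Rightarrow> nat set" where
  "descents n \<sigma> = {i \<in> {1..n - 1}. \<sigma> i > \<sigma> (i + 1)}"

definition num_descents :: "nat \<Rightarrow> (nat \<Rightarrow> nat) \<Rightarrow> int" where
  "num_descents n \<sigma> = int (card (descents n \<sigma>))"

definition num_ascents :: "nat \<Rightarrow> (nat \<Rightarrow> nat) \<Rightarrow> int" where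
  "num_ascents n \<sigma> = int (card ({1..n - 1} - descents n \<sigma>))"

text \<open>A contiguous subsequence is given by its first and last position.\<close>

definition increasing_segment :: "nat \<Rightarrow> (nat \<Rightarrow> nat) \<Rightarrow> nat \<Rightarrow> nat \<Rightarrow> bool" where
  "increasing_segment n \<sigma> a b \<longleftrightarrow> 1 \<le> a \<and> a \<le> b \<and> b \<le> n \<and> strict_mono_on {a..b} \<sigma>"

definition runs :: "nat \<Rightarrow> (nat \<Rightarrow> nat) \<Rightarrow> (nat \<times> nat) set" where
  "runs n \<sigma> = {(a, b). increasing_segment n \<sigma> a b \<and>
     (\<forall>a' b'. increasing_segment n \<sigma> a' b' \<and> {a..b} \<subseteq> {a'..b'} \<longrightarrow> a' = a \<and> b' = b)}"

definition num_runs :: "nat \<Rightarrow> (nat \<Rightarrow> nat) \<Rightarrow> int" where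
  "num_runs n \<sigma> = int (card (runs n \<sigma>))"

definition num_cyclic_descents :: "nat \<Rightarrow> (nat \<Rightarrow> nat) \<Rightarrow> int" where
  "num_cyclic_descents n \<sigma> = num_descents n \<sigma> + (if \<sigma> n < \<sigma> 1 then 1 else 0)"

text \<open>For \<open>n < d\<close> the truncated \<open>n - d\<close> is \<open>0\<close>, so the range of \<open>i\<close> is empty, as intended.\<close>

definition descents_dist :: "nat \<Rightarrow> nat \<Rightarrow> (nat \<Rightarrow> nat) \<Rightarrow> nat set" where
  "descents_dist d n \<sigma> = {i \<in> {1..n - d}. \<sigma> i > \<sigma> (i + d)}"

definition num_descents_dist2 :: "nat \<Rightarrow> (nat \<Rightarrow> nat) \<Rightarrow> int" where
  "num_descents_dist2 n \<sigma> = int (card (descents_dist 2 n \<sigma>))"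

definition num_ascents_dist2 :: "nat \<Rightarrow> (nat \<Rightarrow> nat) \<Rightarrow> int" where
  "num_ascents_dist2 n \<sigma> = int (card ({1..n - 2} - descents_dist 2 n \<sigma>))"

definition num_strict_3_descents :: "nat \<Rightarrow> (nat \<Rightarrow> nat) \<Rightarrow> int" where
  "num_strict_3_descents n \<sigma> = int (card (descents_dist 3 n \<sigma>))"

text \<open>A rooted tree with root \<open>0\<close> is given by its parent function \<open>par\<close>, where \<open>par 0 = 0\<close>.
  The path from \<open>u\<close> to the root is \<open>u, par u, par (par u), \<dots>, 0\<close>, so for \<open>v > 0\<close> the following is
  the first node smaller than \<open>v\<close> on that path (which includes \<open>u\<close> itself).\<close>

definition first_smaller :: "(nat \<Rightarrow> nat) \<Rightarrow> nat \<Rightarrow> nat \<Rightarrow> nat" where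
  "first_smaller par u v = (par ^^ (LEAST k. (par ^^ k) u < v)) u"

text \<open>\<open>tree_parent \<sigma> i\<close> is the parent function of the tree after inserting
  \<open>\<sigma> 1, \<dots>, \<sigma> i\<close>; its values at nodes not yet inserted are irrelevant.\<close>

fun tree_parent :: "(nat \<Rightarrow> nat) \<Rightarrow> nat \<Rightarrow> nat \<Rightarrow> nat" where
  "tree_parent \<sigma> 0 = (\<lambda>_. 0)"
| "tree_parent \<sigma> (Suc 0) = (tree_parent \<sigma> 0)(\<sigma> 1 := 0)"
| "tree_parent \<sigma> (Suc (Suc i)) = (tree_parent \<sigma> (Suc i))
     (\<sigma> (Suc (Suc i)) := first_smaller (tree_parent \<sigma> (Suc i)) (\<sigma> (Suc i)) (\<sigma> (Suc (Suc i))))"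

definition permutation_tree_edges :: "nat \<Rightarrow> (nat \<Rightarrow> nat) \<Rightarrow> (nat \<times> nat) set" where
  "permutation_tree_edges n \<sigma> = {(tree_parent \<sigma> n v, v) | v. v \<in> {1..n}}"

definition tree_width :: "nat \<Rightarrow> (nat \<Rightarrow> nat) \<Rightarrow> int" where
  "tree_width n \<sigma> = int (card {u \<in> {0..n}. \<forall>v. (u, v) \<notin> permutation_tree_edges n \<sigma>})"

definition cosine :: "nat \<Rightarrow> (nat \<Rightarrow> nat) \<Rightarrow> int" where
  "cosine n \<sigma> = (\<Sum>i=1..n. int i * int (\<sigma> i))"

definition num_recoils :: "nat \<Rightarrow> (nat \<Rightarrow> nat) \<Rightarrow> int" where
  "num_recoils n \<sigma> = int (card {i \<in> {1..n - 1}. inv \<sigma> (i + 1) < inv \<sigma> i})"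

definition same_relative_order :: "nat list \<Rightarrow> nat list \<Rightarrow> bool" where
  "same_relative_order xs ys \<longleftrightarrow> length xs = length ys \<and>
     (\<forall>p < length xs. \<forall>q < length xs. xs ! p < xs ! q \<longleftrightarrow> ys ! p < ys ! q)"

definition num_occurrences3 :: "nat list \<Rightarrow> nat \<Rightarrow> (nat \<Rightarrow> nat) \<Rightarrow> int" where
  "num_occurrences3 w n \<sigma> = int (card {(i\<^sub>1, i\<^sub>2, i\<^sub>3). 1 \<le> i\<^sub>1 \<and> i\<^sub>1 < i\<^sub>2 \<and> i\<^sub>2 < i\<^sub>3 \<and> i\<^sub>3 \<le> n \<and>
     same_relative_order [\<sigma> i\<^sub>1, \<sigma> i\<^sub>2, \<sigma> i\<^sub>3] w})"

definition spearman_rho :: "nat \<Rightarrow> (nat \<Rightarrow> nat) \<Rightarrow> int" where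
  "spearman_rho n \<sigma> = (\<Sum>i=1..n. (int (\<sigma> i) - int i)\<^sup>2)"

text \<open>The integer division in the standardized bi-alternating inversion number is exact.\<close>

lemma even_bialternating_aux:
  assumes "inj_on \<sigma> {1..n}"
  shows "even (bialternating_sum n \<sigma> + (int (n div 2))\<^sup>2)"
  using assms
proof (induction n)
  case 0
  then show ?case by (simp add: bialternating_sum_def)
next
  case (Suc n)
  let ?t = "\<lambda>y. (-1) ^ (Suc n + y) * sgn (int (\<sigma> (Suc n)) - int (\<sigma> y))"
  have IH: "even (bialternating_sum n \<sigma> + (int (n div 2))\<^sup>2)"
    using Suc.prems by (intro Suc.IH) (auto elim: inj_on_subset)
  have odd: "odd (?t y)" if "y \<in> {1..n}" for y
  proof -
    have "\<sigma> (Suc n) \<noteq> \<sigma> y"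
      using inj_onD[OF Suc.prems, of "Suc n" y] that by auto
    then show ?thesis by (auto simp: sgn_if)
  qed
  have "{y \<in> {1..n}. odd (?t y)} = {1..n}"
    using odd by blast
  then have "even (\<Sum>y=1..n. ?t y) \<longleftrightarrow> even n"
    by (subst even_sum_iff) simp_all
  moreover have "bialternating_sum (Suc n) \<sigma> = bialternating_sum n \<sigma> + (\<Sum>y=1..n. ?t y)"
    by (simp add: bialternating_sum_def atLeastLessThanSuc_atLeastAtMost)
  moreover have "even ((int (Suc n div 2))\<^sup>2) \<longleftrightarrow> (even ((int (n div 2))\<^sup>2) \<longleftrightarrow> even n)"
    by (cases "even n") (auto elim!: evenE oddE)
  ultimately show ?case using IH by auto
qed

lemma two_times_std_bialternating_inversion_number:
  assumes "\<sigma> \<in> Sym n"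
  shows "2 * std_bialternating_inversion_number n \<sigma> = bialternating_sum n \<sigma> + (int (n div 2))\<^sup>2"
proof -
  have "inj_on \<sigma> {1..n}"
    using assms by (auto simp: Sym_def intro: permutes_inj_on)
  from even_bialternating_aux[OF this] show ?thesis
    unfolding std_bialternating_inversion_number_def by (rule dvd_mult_div_cancel)
qed

end

theory Submission
  imports Defs
begin

text \<open>Both maps are involutions, so a statistic \<open>f\<close> with \<open>f \<sigma> + f (X \<sigma>)\<close> constant is homomesic.
  Reversal and complementation both exchange inversions with non-inversions, and reversal moves a
  pair of positions \<open>(i, j)\<close> to \<open>(n + 1 - j, n + 1 - i)\<close>; hence any sum over the inversions of
  weights that are invariant under this reflection has that property. Apart from the cosine,
  Spearman's rho and the pattern count, every statistic is an affine function of such a sum, or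
  of one for the inverse permutation. For the pattern count, note that 132, 213, 321 are exactly
  the odd patterns of length 3, and both maps change the parity of a triple.\<close>

section \<open>Statistics antisymmetric under reversal and complementation\<close>

lemma reverse_map_in_Sym:
  assumes "\<sigma> \<in> Sym n"
  shows "reverse_map n \<sigma> \<in> Sym n"
proof -
  have s: "\<sigma> permutes {1..n}" using assms by (simp add: Sym_def)
  have "bij_betw (\<lambda>i. n + 1 - i) {1..n} {1..n}"
    by (rule bij_betw_byWitness[where f' = "\<lambda>i. n + 1 - i"]) auto
  then have "bij_betw (\<sigma> \<circ> (\<lambda>i. n + 1 - i)) {1..n} {1..n}"
    using permutes_imp_bij[OF s] by (rule bij_betw_trans)
  then have "bij_betw (reverse_map n \<sigma>) {1..n} {1..n}"
    by (rule bij_betw_cong[THEN iffD1, rotated]) (auto simp: reverse_map_def)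
  then show ?thesis
    unfolding Sym_def mem_Collect_eq by (rule bij_imp_permutes) (auto simp: reverse_map_def)
qed

lemma complement_map_in_Sym:
  assumes "\<sigma> \<in> Sym n"
  shows "complement_map n \<sigma> \<in> Sym n"
proof -
  have s: "\<sigma> permutes {1..n}" using assms by (simp add: Sym_def)
  have "bij_betw (\<lambda>i. n + 1 - i) {1..n} {1..n}"
    by (rule bij_betw_byWitness[where f' = "\<lambda>i. n + 1 - i"]) auto
  then have "bij_betw ((\<lambda>i. n + 1 - i) \<circ> \<sigma>) {1..n} {1..n}"
    using permutes_imp_bij[OF s] by (rule bij_betw_trans[rotated])
  then have "bij_betw (complement_map n \<sigma>) {1..n} {1..n}"
    by (rule bij_betw_cong[THEN iffD1, rotated]) (auto simp: complement_map_def)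
  then show ?thesis
    unfolding Sym_def mem_Collect_eq by (rule bij_imp_permutes) (auto simp: complement_map_def)
qed

lemma Sym_range:
  assumes "\<sigma> \<in> Sym n" "i \<in> {1..n}"
  shows "1 \<le> \<sigma> i" "\<sigma> i \<le> n"
  using permutes_in_image[of \<sigma> "{1..n}" i] assms by (auto simp: Sym_def)

lemma Sym_eq_iff:
  assumes "\<sigma> \<in> Sym n"
  shows "\<sigma> i = \<sigma> j \<longleftrightarrow> i = j"
  using assms permutes_inj[of \<sigma> "{1..n}"] by (auto simp: Sym_def inj_eq)

lemma Sym_outside:
  assumes "\<sigma> \<in> Sym n" "i \<notin> {1..n}"
  shows "\<sigma> i = i"
  using assms by (auto simp: Sym_def permutes_not_in)

lemma reverse_map_involution:
  assumes "\<sigma> \<in> Sym n"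
  shows "reverse_map n (reverse_map n \<sigma>) = \<sigma>"
  using Sym_outside[OF assms] by (auto simp: reverse_map_def fun_eq_iff)

lemma complement_map_involution:
  assumes "\<sigma> \<in> Sym n"
  shows "complement_map n (complement_map n \<sigma>) = \<sigma>"
proof
  fix i
  show "complement_map n (complement_map n \<sigma>) i = \<sigma> i"
    using Sym_outside[OF assms, of i] Sym_range[OF assms, of i] by (auto simp: complement_map_def)
qed

section \<open>Antisymmetric statistics and how they yield homomesy\<close>

text \<open>Sharing one \<open>c\<close> between the two maps loses no generality: each map permutes
  \<open>Sym n\<close>, so summing either identity over \<open>Sym n\<close> gives \<open>c\<close>
  times n! as twice the total of \<open>f\<close>.\<close>

definition antisymmetric_statistic :: "nat \<Rightarrow> ((nat \<Rightarrow> nat) \<Rightarrow> int) \<Rightarrow> bool" where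
  "antisymmetric_statistic n f \<longleftrightarrow> (\<exists>c. \<forall>\<sigma>\<in>Sym n.
     f \<sigma> + f (reverse_map n \<sigma>) = c \<and> f \<sigma> + f (complement_map n \<sigma>) = c)"

text \<open>Every orbit is \<open>{x, X x}\<close>, and its average is \<open>c / 2\<close>, also
  when \<open>x\<close> is a fixed point.\<close>

lemma homomesic_involution:
  assumes "finite S" and maps: "\<And>x. x \<in> S \<Longrightarrow> X x \<in> S" and inv: "\<And>x. x \<in> S \<Longrightarrow> X (X x) = x"
    and sum: "\<And>x. x \<in> S \<Longrightarrow> f x + f (X x) = c"
  shows "homomesic S X f"
proof -
  have "bij_betw X S S"
    by (rule bij_betw_byWitness[where f' = X]) (use maps inv in auto)
  moreover have "(\<Sum>y\<in>orbit X x. real_of_int (f y)) / real (card (orbit X x)) = real_of_int c / 2"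
    if "x \<in> S" for x
  proof -
    have "y \<in> {x, X x}" if "y \<in> orbit X x" for y
      using that by induction (use inv[OF \<open>x \<in> S\<close>] in auto)
    \<comment> \<open>\<open>orbit X x\<close> is generated from \<open>X x\<close>, not from
      \<open>x\<close>; the point \<open>x\<close> enters only as \<open>X (X x)\<close>.\<close>
    moreover have "X x \<in> orbit X x" "X (X x) \<in> orbit X x"
      by (auto intro: orbit.intros)
    ultimately have orb: "orbit X x = {x, X x}"
      using inv[OF that] by auto
    have "real_of_int (f x) + real_of_int (f (X x)) = real_of_int c"
      using sum[OF that] by (metis of_int_add)
    \<comment> \<open>At a fixed point the orbit is a singleton, and the hypothesis reads 2 *
      \<open>f x\<close> = \<open>c\<close>.\<close>
    then show ?thesis
      by (cases "X x = x") (auto simp: orb)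
  qed
  ultimately show ?thesis
    unfolding homomesic_def using \<open>finite S\<close> by blast
qed

lemma antisymmetric_statistic_imp_homomesic:
  assumes "antisymmetric_statistic n f" "X \<in> {reverse_map n, complement_map n}"
  shows "homomesic (Sym n) X f"
proof -
  have fin: "finite (Sym n)"
    by (simp add: Sym_def finite_permutations)
  obtain c where c: "\<And>\<sigma>. \<sigma> \<in> Sym n \<Longrightarrow> f \<sigma> + f (reverse_map n \<sigma>) = c"
    "\<And>\<sigma>. \<sigma> \<in> Sym n \<Longrightarrow> f \<sigma> + f (complement_map n \<sigma>) = c"
    using assms(1) unfolding antisymmetric_statistic_def by blast
  have "homomesic (Sym n) (reverse_map n) f"
    by (rule homomesic_involution[where c = c])
      (simp_all add: fin reverse_map_in_Sym reverse_map_involution c(1))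
  moreover have "homomesic (Sym n) (complement_map n) f"
    by (rule homomesic_involution[where c = c])
      (simp_all add: fin complement_map_in_Sym complement_map_involution c(2))
  ultimately show ?thesis using assms(2) by auto
qed

text \<open>The offset \<open>b\<close> is counted once at each of the two paired permutations,
  which gives the constant \<open>a * c + 2 * b\<close>. A negative \<open>a\<close> covers
  complementary counts such as ascents.\<close>

lemma antisymmetric_statistic_affine:
  assumes "antisymmetric_statistic n f"
    and "\<And>\<sigma>. \<sigma> \<in> Sym n \<Longrightarrow> g \<sigma> = a * f \<sigma> + b"
  shows "antisymmetric_statistic n g"
proof -
  obtain c where c: "\<And>\<sigma>. \<sigma> \<in> Sym n \<Longrightarrow> f \<sigma> + f (reverse_map n \<sigma>) = c"
    "\<And>\<sigma>. \<sigma> \<in> Sym n \<Longrightarrow> f \<sigma> + f (complement_map n \<sigma>) = c"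
    using assms(1) unfolding antisymmetric_statistic_def by blast
  have "g \<sigma> + g \<tau> = a * c + 2 * b" if "\<sigma> \<in> Sym n" "\<tau> \<in> Sym n" "f \<sigma> + f \<tau> = c" for \<sigma> \<tau>
  proof -
    have "g \<sigma> + g \<tau> = a * (f \<sigma> + f \<tau>) + 2 * b"
      using assms(2) that(1,2) by (simp add: distrib_left)
    then show ?thesis by (simp add: that(3))
  qed
  then have "\<forall>\<sigma>\<in>Sym n. g \<sigma> + g (reverse_map n \<sigma>) = a * c + 2 * b
      \<and> g \<sigma> + g (complement_map n \<sigma>) = a * c + 2 * b"
    using c reverse_map_in_Sym complement_map_in_Sym by blast
  then show ?thesis unfolding antisymmetric_statistic_def by blast
qed

lemma antisymmetric_statistic_add:
  assumes "antisymmetric_statistic n f" "antisymmetric_statistic n g"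
  shows "antisymmetric_statistic n (\<lambda>\<sigma>. f \<sigma> + g \<sigma>)"
proof -
  obtain c where c: "\<And>\<sigma>. \<sigma> \<in> Sym n \<Longrightarrow> f \<sigma> + f (reverse_map n \<sigma>) = c"
    "\<And>\<sigma>. \<sigma> \<in> Sym n \<Longrightarrow> f \<sigma> + f (complement_map n \<sigma>) = c"
    using assms(1) unfolding antisymmetric_statistic_def by blast
  obtain d where d: "\<And>\<sigma>. \<sigma> \<in> Sym n \<Longrightarrow> g \<sigma> + g (reverse_map n \<sigma>) = d"
    "\<And>\<sigma>. \<sigma> \<in> Sym n \<Longrightarrow> g \<sigma> + g (complement_map n \<sigma>) = d"
    using assms(2) unfolding antisymmetric_statistic_def by blast
  have "f \<sigma> + g \<sigma> + (f (reverse_map n \<sigma>) + g (reverse_map n \<sigma>)) = c + d \<and>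
      f \<sigma> + g \<sigma> + (f (complement_map n \<sigma>) + g (complement_map n \<sigma>)) = c + d" if "\<sigma> \<in> Sym n" for \<sigma>
    using c[OF that] d[OF that] by linarith
  then show ?thesis unfolding antisymmetric_statistic_def by blast
qed

section \<open>Weighted inversion sums\<close>

definition position_pairs :: "nat \<Rightarrow> (nat \<times> nat) set" where
  "position_pairs n = {(i, j). 1 \<le> i \<and> i < j \<and> j \<le> n}"

lemma finite_position_pairs: "finite (position_pairs n)"
  by (rule finite_subset[of _ "{1..n} \<times> {1..n}"]) (auto simp: position_pairs_def)

lemma inversions_subset: "inversions n \<sigma> \<subseteq> position_pairs n"
  by (auto simp: inversions_def position_pairs_def)

lemma finite_inversions: "finite (inversions n \<sigma>)"
  using inversions_subset finite_position_pairs by (rule finite_subset)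

lemma non_inversions_eq:
  assumes "\<sigma> \<in> Sym n"
  shows "non_inversions n \<sigma> = position_pairs n - inversions n \<sigma>"
proof -
  have "\<sigma> i \<noteq> \<sigma> j" if "i < j" for i j using Sym_eq_iff[OF assms] that by auto
  then show ?thesis
    by (fastforce simp: inversions_def non_inversions_def position_pairs_def not_less le_less)
qed

lemma sum_non_inversions:
  fixes w :: "nat \<times> nat \<Rightarrow> int"
  assumes "\<sigma> \<in> Sym n"
  shows "sum w (non_inversions n \<sigma>) = sum w (position_pairs n) - sum w (inversions n \<sigma>)"
  unfolding non_inversions_eq[OF assms]
  by (rule sum_diff[OF finite_position_pairs inversions_subset])

lemma inversions_complement_map:
  assumes "\<sigma> \<in> Sym n"
  shows "inversions n (complement_map n \<sigma>) = non_inversions n \<sigma>"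
proof -
  have "n + 1 - \<sigma> j < n + 1 - \<sigma> i \<longleftrightarrow> \<sigma> i < \<sigma> j" if "1 \<le> i" "i < j" "j \<le> n" for i j
    using Sym_range[OF assms, of i] Sym_range[OF assms, of j] that by auto
  then show ?thesis
    by (auto simp: inversions_def non_inversions_def complement_map_def)
qed

text \<open>The coordinates are exchanged as well as reflected, so that the smaller position stays
  first.\<close>

definition reflect_pair :: "nat \<Rightarrow> nat \<times> nat \<Rightarrow> nat \<times> nat" where
  "reflect_pair n = (\<lambda>(i, j). (n + 1 - j, n + 1 - i))"

text \<open>The reversed word reads \<open>\<sigma>\<close> at the reflected positions in the
  opposite order, so a fall becomes a rise. The reflection is its own inverse.\<close>

lemma bij_betw_reflect_inversions:
  "bij_betw (reflect_pair n) (inversions n (reverse_map n \<sigma>)) (non_inversions n \<sigma>)"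
  by (rule bij_betw_byWitness[where f' = "reflect_pair n"])
    (auto simp: reflect_pair_def inversions_def non_inversions_def reverse_map_def)

text \<open>For either map the second sum equals the sum of \<open>w\<close> over the non-inversions
  of \<open>\<sigma>\<close>: directly for the complement, after reindexing by the reflection for
  the reverse. The constant is therefore the total weight of all position pairs.\<close>

lemma antisymmetric_weighted_inversions:
  fixes w :: "nat \<times> nat \<Rightarrow> int"
  assumes w: "\<And>p. p \<in> position_pairs n \<Longrightarrow> w (reflect_pair n p) = w p"
  shows "antisymmetric_statistic n (\<lambda>\<sigma>. sum w (inversions n \<sigma>))"
proof -
  have "sum w (inversions n \<sigma>) + sum w (inversions n (reverse_map n \<sigma>)) = sum w (position_pairs n)"
    if "\<sigma> \<in> Sym n" for \<sigma>
  proof -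
    have "sum w (inversions n (reverse_map n \<sigma>))
        = (\<Sum>p\<in>inversions n (reverse_map n \<sigma>). w (reflect_pair n p))"
      by (rule sum.cong[OF refl]) (rule w[symmetric], rule subsetD[OF inversions_subset])
    also have "\<dots> = sum w (non_inversions n \<sigma>)"
      by (rule sum.reindex_bij_betw[OF bij_betw_reflect_inversions])
    finally show ?thesis using sum_non_inversions[OF that, of w] by simp
  qed
  moreover have "sum w (inversions n \<sigma>) + sum w (inversions n (complement_map n \<sigma>))
      = sum w (position_pairs n)" if "\<sigma> \<in> Sym n" for \<sigma>
    by (simp add: inversions_complement_map[OF that] sum_non_inversions[OF that])
  ultimately show ?thesis unfolding antisymmetric_statistic_def by blast
qed

lemma card_eq_sum_indicator:
  assumes "finite A"
  shows "int (card {x \<in> A. P x}) = (\<Sum>x\<in>A. if P x then 1 else 0)"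
  using assms by (simp add: sum.If_cases Int_def conj_commute)

lemma antisymmetric_card_inversions:
  assumes "\<And>p. p \<in> position_pairs n \<Longrightarrow> P (reflect_pair n p) = P p"
  shows "antisymmetric_statistic n (\<lambda>\<sigma>. int (card {p \<in> inversions n \<sigma>. P p}))"
  unfolding card_eq_sum_indicator[OF finite_inversions]
  by (rule antisymmetric_weighted_inversions) (simp add: assms)

section \<open>Counts and sums of inversions and non-inversions\<close>

lemma antisymmetric_num_inversions: "antisymmetric_statistic n (num_inversions n)"
  using antisymmetric_card_inversions[of n "\<lambda>_. True"] by (simp add: num_inversions_def[abs_def])

lemma antisymmetric_inversion_sum: "antisymmetric_statistic n (inversion_sum n)"
  unfolding inversion_sum_def
  by (rule antisymmetric_weighted_inversions)
    (auto simp: position_pairs_def reflect_pair_def of_nat_diff)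

lemma antisymmetric_num_non_inversions: "antisymmetric_statistic n (num_non_inversions n)"
proof (rule antisymmetric_statistic_affine[OF antisymmetric_num_inversions])
  fix \<sigma> assume "\<sigma> \<in> Sym n"
  from sum_non_inversions[OF this, of "\<lambda>_. 1"]
  show "num_non_inversions n \<sigma> = (-1) * num_inversions n \<sigma> + int (card (position_pairs n))"
    by (simp add: num_non_inversions_def num_inversions_def)
qed

lemma antisymmetric_non_inversion_sum: "antisymmetric_statistic n (non_inversion_sum n)"
proof (rule antisymmetric_statistic_affine[OF antisymmetric_inversion_sum])
  fix \<sigma> assume "\<sigma> \<in> Sym n"
  from sum_non_inversions[OF this, of "\<lambda>(a, b). int b - int a"]
  show "non_inversion_sum n \<sigma> = (-1) * inversion_sum n \<sigma>
      + (\<Sum>(a, b)\<in>position_pairs n. int b - int a)"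
    by (simp add: non_inversion_sum_def inversion_sum_def)
qed

lemma antisymmetric_num_inversions_dist_le: "antisymmetric_statistic n (num_inversions_dist_le d n)"
proof -
  have "antisymmetric_statistic n (\<lambda>\<sigma>. int (card {p \<in> inversions n \<sigma>. case p of (i, j) \<Rightarrow> j - i \<le> d}))"
    by (rule antisymmetric_card_inversions) (auto simp: position_pairs_def reflect_pair_def)
  then show ?thesis
    by (simp add: num_inversions_dist_le_def[abs_def] case_prod_unfold)
qed

lemma mod_2_reflect:
  fixes i j m :: nat
  assumes "i \<le> m" "j \<le> m"
  shows "(m - j) mod 2 = (m - i) mod 2 \<longleftrightarrow> i mod 2 = j mod 2"
  using assms by (auto simp: mod2_eq_if)

lemma antisymmetric_num_even_inversions: "antisymmetric_statistic n (num_even_inversions n)"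
proof -
  have "antisymmetric_statistic n
      (\<lambda>\<sigma>. int (card {p \<in> inversions n \<sigma>. case p of (i, j) \<Rightarrow> i mod 2 = j mod 2}))"
    by (rule antisymmetric_card_inversions) (auto simp: position_pairs_def reflect_pair_def mod_2_reflect)
  then show ?thesis
    by (simp add: num_even_inversions_def[abs_def] case_prod_unfold)
qed

lemma antisymmetric_num_odd_inversions: "antisymmetric_statistic n (num_odd_inversions n)"
proof -
  have "antisymmetric_statistic n
      (\<lambda>\<sigma>. int (card {p \<in> inversions n \<sigma>. case p of (i, j) \<Rightarrow> i mod 2 \<noteq> j mod 2}))"
    by (rule antisymmetric_card_inversions) (auto simp: position_pairs_def reflect_pair_def mod_2_reflect)
  then show ?thesis
    by (simp add: num_odd_inversions_def[abs_def] case_prod_unfold)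
qed

section \<open>The bi-alternating inversion number\<close>

text \<open>The sign factor is -1 on inversions and +1 on non-inversions, so the signed sum is the
  total weight minus twice the weight of the inversions.\<close>

lemma bialternating_sum_eq:
  assumes "\<sigma> \<in> Sym n"
  shows "bialternating_sum n \<sigma> = (\<Sum>(i, j)\<in>position_pairs n. (-1) ^ (i + j))
    - 2 * (\<Sum>(i, j)\<in>inversions n \<sigma>. (-1) ^ (i + j))"
proof -
  let ?w = "\<lambda>(i, j). (-1) ^ (i + j) :: int"
  have "bialternating_sum n \<sigma> = (\<Sum>(x, y)\<in>(SIGMA x:{1..n}. {1..<x}).
      (-1) ^ (x + y) * sgn (int (\<sigma> x) - int (\<sigma> y)))"
    unfolding bialternating_sum_def by (rule sum.Sigma) auto
  \<comment> \<open>The double sum lists the larger position first, whereas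
    \<open>position_pairs\<close> lists the smaller one first.\<close>
  also have "\<dots> = (\<Sum>(i, j)\<in>position_pairs n. (-1) ^ (i + j) * sgn (int (\<sigma> j) - int (\<sigma> i)))"
    by (rule sum.reindex_bij_witness[where i = "\<lambda>(x, y). (y, x)" and j = "\<lambda>(x, y). (y, x)"])
      (auto simp: position_pairs_def add.commute)
  also have "\<dots> = (\<Sum>(i, j)\<in>inversions n \<sigma>. (-1) ^ (i + j) * sgn (int (\<sigma> j) - int (\<sigma> i)))
      + (\<Sum>(i, j)\<in>non_inversions n \<sigma>. (-1) ^ (i + j) * sgn (int (\<sigma> j) - int (\<sigma> i)))"
    unfolding sum_non_inversions[OF assms] by simp
  also have "(\<Sum>(i, j)\<in>inversions n \<sigma>. (-1) ^ (i + j) * sgn (int (\<sigma> j) - int (\<sigma> i)))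
      = - sum ?w (inversions n \<sigma>)"
    unfolding sum_negf[symmetric] by (rule sum.cong) (auto simp: inversions_def sgn_if)
  also have "(\<Sum>(i, j)\<in>non_inversions n \<sigma>. (-1) ^ (i + j) * sgn (int (\<sigma> j) - int (\<sigma> i)))
      = sum ?w (non_inversions n \<sigma>)"
    by (rule sum.cong) (auto simp: non_inversions_def sgn_if)
  finally show ?thesis
    using sum_non_inversions[OF assms, of ?w] by simp
qed

lemma antisymmetric_std_bialternating:
  "antisymmetric_statistic n (std_bialternating_inversion_number n)"
proof -
  let ?w = "\<lambda>(i, j). (-1) ^ (i + j) :: int"
  define c where "c = (sum ?w (position_pairs n) + (int (n div 2))\<^sup>2)"
  have "antisymmetric_statistic n (\<lambda>\<sigma>. sum ?w (inversions n \<sigma>))"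
  proof (rule antisymmetric_weighted_inversions)
    fix p assume p: "p \<in> position_pairs n"
    obtain i j where ij: "p = (i, j)" by force
    \<comment> \<open>The two reflected positions add up to 2 * (n + 1) - (i + j).\<close>
    have "even (n + 1 - j + (n + 1 - i)) \<longleftrightarrow> even (i + j)"
      using p by (auto simp: ij position_pairs_def)
    then show "?w (reflect_pair n p) = ?w p"
      by (simp add: ij reflect_pair_def minus_one_power_iff)
  qed
  then show ?thesis
  proof (rule antisymmetric_statistic_affine)
    fix \<sigma> assume \<sigma>: "\<sigma> \<in> Sym n"
    have "2 * std_bialternating_inversion_number n \<sigma> = c - 2 * sum ?w (inversions n \<sigma>)"
      unfolding two_times_std_bialternating_inversion_number[OF \<sigma>] bialternating_sum_eq[OF \<sigma>] c_def
      by simp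
    \<comment> \<open>The equation forces \<open>c\<close> to be even, so \<open>c div 2\<close> is
      exact.\<close>
    then show "std_bialternating_inversion_number n \<sigma> = (-1) * sum ?w (inversions n \<sigma>) + c div 2"
      by linarith
  qed
qed

section \<open>Descents\<close>

text \<open>A descent \<open>i\<close> of distance \<open>d\<close> is the inversion
  \<open>(i, i + d)\<close>. The condition \<open>j = i + d\<close> is invariant under reflection,
  so the general result on inversions applies.\<close>

lemma card_descents_dist:
  assumes "d \<ge> 1"
  shows "card (descents_dist d n \<sigma>) = card {(i, j) \<in> inversions n \<sigma>. j = i + d}"
  by (rule bij_betw_same_card[of "\<lambda>i. (i, i + d)"],
      rule bij_betw_byWitness[where f' = fst])
    (use assms in \<open>auto simp: descents_dist_def inversions_def\<close>)

lemma antisymmetric_card_descents_dist: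
  assumes "d \<ge> 1"
  shows "antisymmetric_statistic n (\<lambda>\<sigma>. int (card (descents_dist d n \<sigma>)))"
proof -
  have "antisymmetric_statistic n (\<lambda>\<sigma>. int (card {p \<in> inversions n \<sigma>. case p of (i, j) \<Rightarrow> j = i + d}))"
    by (rule antisymmetric_card_inversions) (auto simp: position_pairs_def reflect_pair_def)
  then show ?thesis
    by (simp add: card_descents_dist[OF assms] case_prod_unfold)
qed

lemma antisymmetric_card_ascents_dist:
  assumes "d \<ge> 1"
  shows "antisymmetric_statistic n (\<lambda>\<sigma>. int (card ({1..n - d} - descents_dist d n \<sigma>)))"
proof (rule antisymmetric_statistic_affine[OF antisymmetric_card_descents_dist[OF assms]])
  fix \<sigma>
  have sub: "descents_dist d n \<sigma> \<subseteq> {1..n - d}" by (auto simp: descents_dist_def)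
  then have "card (descents_dist d n \<sigma>) \<le> n - d"
    using card_mono[OF _ sub] by simp
  then show "int (card ({1..n - d} - descents_dist d n \<sigma>))
      = (-1) * int (card (descents_dist d n \<sigma>)) + int (n - d)"
    using sub by (simp add: card_Diff_subset finite_subset[OF sub] of_nat_diff)
qed

lemma descents_eq_descents_dist: "descents n \<sigma> = descents_dist 1 n \<sigma>"
  by (simp add: descents_def descents_dist_def)

lemma antisymmetric_num_descents: "antisymmetric_statistic n (num_descents n)"
  using antisymmetric_card_descents_dist[of 1 n]
  by (simp add: num_descents_def[abs_def] descents_eq_descents_dist)

lemma antisymmetric_num_ascents: "antisymmetric_statistic n (num_ascents n)"
  using antisymmetric_card_ascents_dist[of 1 n]
  by (simp add: num_ascents_def[abs_def] descents_eq_descents_dist)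

lemma antisymmetric_num_descents_dist2: "antisymmetric_statistic n (num_descents_dist2 n)"
  unfolding num_descents_dist2_def by (rule antisymmetric_card_descents_dist) simp

lemma antisymmetric_num_ascents_dist2: "antisymmetric_statistic n (num_ascents_dist2 n)"
  unfolding num_ascents_dist2_def by (rule antisymmetric_card_ascents_dist) simp

lemma antisymmetric_num_strict_3_descents: "antisymmetric_statistic n (num_strict_3_descents n)"
  unfolding num_strict_3_descents_def by (rule antisymmetric_card_descents_dist) simp

text \<open>The wrap-around term is the indicator of the single inversion \<open>(1, n)\<close>, and
  the pair \<open>(1, n)\<close> is fixed by the reflection.\<close>

lemma antisymmetric_num_cyclic_descents:
  assumes "n \<ge> 1"
  shows "antisymmetric_statistic n (num_cyclic_descents n)"
proof -
  have wrap: "(if \<sigma> n < \<sigma> 1 then 1 else 0) = int (card {p \<in> inversions n \<sigma>. p = (1, n)})" for \<sigma>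
  proof -
    have "{p \<in> inversions n \<sigma>. p = (1, n)} = (if \<sigma> n < \<sigma> 1 then {(1, n)} else {})"
      using assms by (cases "n = 1") (auto simp: inversions_def)
    then show ?thesis by simp
  qed
  have "antisymmetric_statistic n (\<lambda>\<sigma>. int (card {p \<in> inversions n \<sigma>. p = (1, n)}))"
    by (rule antisymmetric_card_inversions) (auto simp: position_pairs_def reflect_pair_def)
  from antisymmetric_statistic_add[OF antisymmetric_num_descents this] show ?thesis
    by (rule antisymmetric_statistic_affine[where a = 1 and b = 0])
      (simp only: num_cyclic_descents_def wrap mult_1 add_0_right)
qed

section \<open>Recoils, as descents of the inverse permutation\<close>

text \<open>On \<open>{1..n}\<close>, with w the map taking i to n + 1 - i, reversal is
  \<open>\<sigma>\<close> composed with w on the right and complementation is the composition on the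
  left. As w is an involution, taking inverses exchanges the two maps.\<close>

lemma inv_reverse_map:
  assumes "\<sigma> \<in> Sym n"
  shows "inv (reverse_map n \<sigma>) = complement_map n (inv \<sigma>)"
proof
  fix k
  have s: "\<sigma> permutes {1..n}" and r: "reverse_map n \<sigma> permutes {1..n}"
    using assms reverse_map_in_Sym[OF assms] by (auto simp: Sym_def)
  have "reverse_map n \<sigma> (complement_map n (inv \<sigma>) k) = k"
    using permutes_in_image[OF permutes_inv[OF s], of k] permutes_inverses(1)[OF s, of k]
    by (auto simp: reverse_map_def complement_map_def)
  then show "inv (reverse_map n \<sigma>) k = complement_map n (inv \<sigma>) k"
    using permutes_inv_eq[OF r] by blast
qed

lemma inv_complement_map:
  assumes "\<sigma> \<in> Sym n"
  shows "inv (complement_map n \<sigma>) = reverse_map n (inv \<sigma>)"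
proof
  fix k
  have s: "\<sigma> permutes {1..n}" and r: "complement_map n \<sigma> permutes {1..n}"
    using assms complement_map_in_Sym[OF assms] by (auto simp: Sym_def)
  have "complement_map n \<sigma> (reverse_map n (inv \<sigma>) k) = k"
    using permutes_in_image[OF permutes_inv[OF s], of "n + 1 - k"] permutes_inverses(1)[OF s, of "n + 1 - k"]
    by (auto simp: reverse_map_def complement_map_def)
  then show "inv (complement_map n \<sigma>) k = reverse_map n (inv \<sigma>) k"
    using permutes_inv_eq[OF r] by blast
qed

lemma num_recoils_eq: "num_recoils n \<sigma> = num_descents n (inv \<sigma>)"
  by (simp add: num_recoils_def num_descents_def descents_def)

text \<open>Passing to inverses exchanges the two maps, and antisymmetry of the descent number holds
  for both of them with the same constant.\<close>

lemma antisymmetric_num_recoils: "antisymmetric_statistic n (num_recoils n)"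
proof -
  have "inv \<sigma> \<in> Sym n" if "\<sigma> \<in> Sym n" for \<sigma>
    using that by (simp add: Sym_def permutes_inv)
  then show ?thesis
    using antisymmetric_num_descents[of n]
    unfolding antisymmetric_statistic_def num_recoils_eq
    by (metis inv_reverse_map inv_complement_map)
qed

section \<open>Runs\<close>

lemma strict_mono_on_extend:
  fixes \<sigma> :: "nat \<Rightarrow> nat"
  assumes "strict_mono_on {a..b} \<sigma>" "a \<le> b" "\<sigma> b < \<sigma> (b + 1)"
  shows "strict_mono_on {a..b + 1} \<sigma>"
proof (rule strict_mono_onI)
  fix x y assume xy: "x \<in> {a..b + 1}" "y \<in> {a..b + 1}" "x < y"
  show "\<sigma> x < \<sigma> y"
  proof (cases "y = b + 1")
    case True
    have "\<sigma> x \<le> \<sigma> b"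
      using strict_mono_onD[OF assms(1), of x b] xy True assms(2) by (cases "x = b") auto
    then show ?thesis using True assms(3) by simp
  next
    case False
    then show ?thesis using strict_mono_onD[OF assms(1), of x y] xy by auto
  qed
qed

text \<open>A run is determined by its last position, which is either a descent or
  \<open>n\<close>.\<close>

lemma bij_betw_runs:
  assumes \<sigma>: "\<sigma> \<in> Sym n" and "n \<ge> 1"
  shows "bij_betw snd (runs n \<sigma>) (insert n (descents n \<sigma>))"
  unfolding bij_betw_def
proof (intro conjI subset_antisym)
  show "inj_on snd (runs n \<sigma>)"
  proof (rule inj_onI)
    fix p q assume pq: "p \<in> runs n \<sigma>" "q \<in> runs n \<sigma>" "snd p = snd q"
    obtain a b a' where eq: "p = (a, b)" "q = (a', b)" using pq(3) by (metis prod.collapse)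
    \<comment> \<open>Two segments with the same right end are nested, so the maximality of the
      larger or the smaller one forces equal starts.\<close>
    have max: "{a..b} \<subseteq> {a'..b} \<longrightarrow> a' = a" "{a'..b} \<subseteq> {a..b} \<longrightarrow> a = a'"
      using pq(1,2) unfolding eq runs_def by blast+
    have "a = a'" using max by (cases "a \<le> a'") auto
    then show "p = q" by (simp add: eq)
  qed
next
  show "snd ` runs n \<sigma> \<subseteq> insert n (descents n \<sigma>)"
  proof
    fix b assume "b \<in> snd ` runs n \<sigma>"
    then obtain a where run: "(a, b) \<in> runs n \<sigma>" by auto
    have inc: "increasing_segment n \<sigma> a b"
      using run unfolding runs_def by blast
    have max: "a' = a \<and> b' = b"
      if "increasing_segment n \<sigma> a' b'" "{a..b} \<subseteq> {a'..b'}" for a' b'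
      using run that unfolding runs_def by blast
    show "b \<in> insert n (descents n \<sigma>)"
    \<comment> \<open>If \<open>b\<close> were an ascent, the segment could be prolonged to
      \<open>b + 1\<close>.\<close>
    proof (rule ccontr)
      assume neg: "b \<notin> insert n (descents n \<sigma>)"
      then have "b + 1 \<le> n" "\<sigma> b < \<sigma> (b + 1)"
        using inc Sym_eq_iff[OF \<sigma>, of b "b + 1"] by (auto simp: increasing_segment_def descents_def)
      then have "increasing_segment n \<sigma> a (b + 1)"
        using inc strict_mono_on_extend[of a b \<sigma>] by (auto simp: increasing_segment_def)
      from max[OF this] show False by auto
    qed
  qed
next
  show "insert n (descents n \<sigma>) \<subseteq> snd ` runs n \<sigma>"
  proof
    fix b assume b: "b \<in> insert n (descents n \<sigma>)"
    have b1: "1 \<le> b" "b \<le> n" using b \<open>n \<ge> 1\<close> by (auto simp: descents_def)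
    \<comment> \<open>This picks the longest increasing segment that ends at
      \<open>b\<close>.\<close>
    define a where "a = (LEAST a. increasing_segment n \<sigma> a b)"
    have "increasing_segment n \<sigma> b b"
      using b1 by (auto simp: increasing_segment_def strict_mono_on_def)
    then have inc: "increasing_segment n \<sigma> a b"
      unfolding a_def by (rule LeastI)
    have "a' = a \<and> b' = b"
      if inc': "increasing_segment n \<sigma> a' b'" and sub: "{a..b} \<subseteq> {a'..b'}" for a' b'
    proof -
      have le: "a' \<le> a" "b \<le> b'" "a \<le> b" using sub inc by (auto simp: increasing_segment_def)
      \<comment> \<open>A larger right end would put an increase at \<open>b\<close>, but
        \<open>b\<close> is a descent or the last position. With \<open>b' = b\<close>, the choice
        of \<open>a\<close> as least settles the left end.\<close>
      have "b' = b"
      proof (rule ccontr)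
        assume "b' \<noteq> b"
        then have "b + 1 \<le> b'" using le by simp
        then have "\<sigma> b < \<sigma> (b + 1)" "b < n"
          using inc' le strict_mono_onD[of "{a'..b'}" \<sigma> b "b + 1"]
          by (auto simp: increasing_segment_def)
        then show False using b by (auto simp: descents_def)
      qed
      moreover from this have "a \<le> a'"
        using inc' unfolding a_def by (auto intro: Least_le)
      ultimately show ?thesis using le by simp
    qed
    then have "(a, b) \<in> runs n \<sigma>" using inc by (auto simp: runs_def)
    then show "b \<in> snd ` runs n \<sigma>" by force
  qed
qed

lemma num_runs_eq:
  assumes "\<sigma> \<in> Sym n" "n \<ge> 1"
  shows "num_runs n \<sigma> = num_descents n \<sigma> + 1"
proof -
  have "n \<notin> descents n \<sigma>" "finite (descents n \<sigma>)"
    using \<open>n \<ge> 1\<close> by (auto simp: descents_def)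
  then show ?thesis
    using bij_betw_same_card[OF bij_betw_runs[OF assms]]
    by (simp add: num_runs_def num_descents_def)
qed

lemma antisymmetric_num_runs:
  assumes "n \<ge> 1"
  shows "antisymmetric_statistic n (num_runs n)"
  by (rule antisymmetric_statistic_affine[OF antisymmetric_num_descents, where a = 1 and b = 1])
    (simp add: num_runs_eq[OF _ assms])

section \<open>The width of the permutation tree\<close>

text \<open>Truncated subtraction lets one hypothesis say both that \<open>f\<close> fixes 0 and
  that it strictly decreases positive numbers. Hence \<open>u\<close> steps from \<open>u\<close>
  reach 0, so the \<open>LEAST\<close> in \<open>first_smaller\<close> ranges over a nonempty
  set.\<close>

lemma funpow_decreasing_le:
  fixes f :: "nat \<Rightarrow> nat"
  assumes "\<And>v. f v \<le> v - 1"
  shows "(f ^^ k) u \<le> u - k"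
proof (induction k)
  case (Suc k)
  then show ?case using assms[of "(f ^^ k) u"] by simp
qed simp

text \<open>The search stops at step 0 exactly when \<open>u < v\<close>. Otherwise the node found
  is the parent of another node on the path and so already has a preimage under
  \<open>par\<close>.\<close>

lemma first_smaller_cases:
  assumes "\<And>v. par v \<le> v - 1" "v > 0"
  shows "first_smaller par u v < v"
    and "u < v \<Longrightarrow> first_smaller par u v = u"
    and "\<not> u < v \<Longrightarrow> first_smaller par u v \<in> range par"
proof -
  define k where "k = (LEAST k. (par ^^ k) u < v)"
  have "(par ^^ u) u < v" using funpow_decreasing_le[of par u u] assms by simp
  then have k: "(par ^^ k) u < v" unfolding k_def by (rule LeastI)
  then show "first_smaller par u v < v" by (simp add: first_smaller_def k_def)
  show "first_smaller par u v = u" if "u < v"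
  proof -
    have "k = 0" unfolding k_def using that by (intro Least_eq_0) simp
    then show ?thesis by (simp add: first_smaller_def k_def[symmetric])
  qed
  show "first_smaller par u v \<in> range par" if "\<not> u < v"
  proof -
    have "k \<noteq> 0" using k that by (intro notI) simp
    then obtain m where "k = Suc m" using not0_implies_Suc by blast
    then show ?thesis by (simp add: first_smaller_def k_def[symmetric])
  qed
qed

text \<open>A node \<open>\<sigma> k\<close> receives a child exactly when \<open>k\<close> is an ascent: otherwise the next node is
  attached to a proper ancestor of \<open>\<sigma> k\<close>, and the path to the root never meets \<open>\<sigma> k\<close> again.\<close>

lemma tree_parent_invariant:
  assumes \<sigma>: "\<sigma> \<in> Sym n" and "i + 1 \<le> n"
  shows "(\<forall>v. tree_parent \<sigma> (Suc i) v \<le> v - 1)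
    \<and> (\<forall>v. v \<notin> \<sigma> ` {1..Suc i} \<longrightarrow> tree_parent \<sigma> (Suc i) v = 0)
    \<and> tree_parent \<sigma> (Suc i) (\<sigma> 1) = 0
    \<and> range (tree_parent \<sigma> (Suc i)) = insert 0 (\<sigma> ` {k \<in> {1..i}. \<sigma> k < \<sigma> (k + 1)})"
  using assms(2)
proof (induction i)
  case 0
  then show ?case by auto
next
  case (Suc i)
  define par where "par = tree_parent \<sigma> (Suc i)"
  define v where "v = \<sigma> (Suc (Suc i))"
  define x where "x = first_smaller par (\<sigma> (Suc i)) v"
  have new: "tree_parent \<sigma> (Suc (Suc i)) = par(v := x)"
    by (simp add: par_def v_def x_def)
  have dec: "\<And>u. par u \<le> u - 1" and out: "\<And>u. u \<notin> \<sigma> ` {1..Suc i} \<Longrightarrow> par u = 0"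
    and one: "par (\<sigma> 1) = 0"
    and ran: "range par = insert 0 (\<sigma> ` {k \<in> {1..i}. \<sigma> k < \<sigma> (k + 1)})"
    using Suc.IH Suc.prems by (auto simp: par_def)
  have "v > 0" using Sym_range[OF \<sigma>, of "Suc (Suc i)"] Suc.prems by (simp add: v_def)
  note fs = first_smaller_cases[of par v "\<sigma> (Suc i)", OF dec \<open>v > 0\<close>, folded x_def]
  have v_fresh: "v \<notin> \<sigma> ` {1..Suc i}" "v \<noteq> \<sigma> 1"
    using Sym_eq_iff[OF \<sigma>] by (auto simp: v_def)
  have par0: "par 0 = 0" using dec[of 0] by simp
  have "range (par(v := x)) = insert x (par ` (- {v}))"
    by (auto simp: image_def)
  \<comment> \<open>Overwriting the value at the fresh node \<open>v\<close> loses nothing from the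
    range: the old value there was the default 0, which is also the value at node 0.\<close>
  also have "par ` (- {v}) = range par"
  proof -
    have "par v = par 0" "0 \<in> - {v}" using out[OF v_fresh(1)] par0 \<open>v > 0\<close> by auto
    then show ?thesis by (metis (no_types, lifting) Compl_insert Diff_insert_absorb
        image_insert insert_Diff insert_image iso_tuple_UNIV_I Compl_eq_Diff_UNIV)
  qed
  finally have "range (par(v := x)) = insert x (insert 0 (\<sigma> ` {k \<in> {1..i}. \<sigma> k < \<sigma> (k + 1)}))"
    by (simp add: ran)
  \<comment> \<open>At an ascent the new parent is \<open>\<sigma> (Suc i)\<close> itself; at a
    descent it was in the range before, so the range does not grow.\<close>
  also have "\<dots> = insert 0 (\<sigma> ` {k \<in> {1..Suc i}. \<sigma> k < \<sigma> (k + 1)})"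
  proof (cases "\<sigma> (Suc i) < v")
    case True
    have "{k \<in> {1..Suc i}. \<sigma> k < \<sigma> (k + 1)} = insert (Suc i) {k \<in> {1..i}. \<sigma> k < \<sigma> (k + 1)}"
      using True by (auto simp: v_def le_Suc_eq)
    then show ?thesis using fs(2)[OF True] by auto
  next
    case False
    have "{k \<in> {1..Suc i}. \<sigma> k < \<sigma> (k + 1)} = {k \<in> {1..i}. \<sigma> k < \<sigma> (k + 1)}"
      using False by (auto simp: v_def le_Suc_eq)
    then show ?thesis using fs(3)[OF False] unfolding ran by auto
  qed
  finally have "range (par(v := x)) = insert 0 (\<sigma> ` {k \<in> {1..Suc i}. \<sigma> k < \<sigma> (k + 1)})" .
  moreover have "(par(v := x)) u \<le> u - 1" for u
    using dec fs(1) by (cases "u = v") auto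
  moreover have "(par(v := x)) u = 0" if "u \<notin> \<sigma> ` {1..Suc (Suc i)}" for u
  proof -
    have "u \<noteq> v" "u \<notin> \<sigma> ` {1..Suc i}" using that by (auto simp: v_def)
    then show ?thesis using out by simp
  qed
  moreover have "(par(v := x)) (\<sigma> 1) = 0" using one v_fresh by simp
  ultimately show ?case unfolding new by blast
qed

text \<open>The nodes with children are 0 and the \<open>\<sigma> k\<close> for ascents
  \<open>k\<close>, which makes \<open>n\<close> minus the number of descents. Of the
  \<open>n + 1\<close> nodes, the number of descents plus 1 remain as leaves.\<close>

lemma tree_width_eq:
  assumes \<sigma>: "\<sigma> \<in> Sym n" and "n \<ge> 1"
  shows "tree_width n \<sigma> = num_descents n \<sigma> + 1"
proof -
  define par where "par = tree_parent \<sigma> n"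
  define A where "A = {1..n - 1} - descents n \<sigma>"
  have s: "\<sigma> permutes {1..n}" using \<sigma> by (simp add: Sym_def)
  have A: "{k \<in> {1..n - 1}. \<sigma> k < \<sigma> (k + 1)} = A"
    using Sym_eq_iff[OF \<sigma>] by (auto simp: A_def descents_def not_less le_less)
  obtain i where i: "n = Suc i" using \<open>n \<ge> 1\<close> by (cases n) auto
  have out: "\<And>v. v \<notin> {1..n} \<Longrightarrow> par v = 0" and one: "par (\<sigma> 1) = 0"
    and ran: "range par = insert 0 (\<sigma> ` A)"
    using tree_parent_invariant[OF \<sigma>, of i] A permutes_image[OF s] by (auto simp: par_def i)
  have one_in: "\<sigma> 1 \<in> {1..n}" using Sym_range[OF \<sigma>, of 1] \<open>n \<ge> 1\<close> by simp
  \<comment> \<open>Outside \<open>{1..n}\<close> the parent function is 0, and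
    \<open>\<sigma> 1\<close> inside also has parent 0, so restricting to actual non-root nodes
    keeps every value.\<close>
  have "par ` {1..n} = range par"
  proof
    show "range par \<subseteq> par ` {1..n}"
    proof
      fix y assume "y \<in> range par"
      then obtain v where "y = par v" by blast
      then show "y \<in> par ` {1..n}"
        using out[of v] one one_in by (cases "v \<in> {1..n}") (auto intro: image_eqI[of _ _ "\<sigma> 1"])
    qed
  qed auto
  then have leaves: "{u \<in> {0..n}. \<forall>v. (u, v) \<notin> permutation_tree_edges n \<sigma>} = {0..n} - insert 0 (\<sigma> ` A)"
    unfolding ran[symmetric] permutation_tree_edges_def par_def[symmetric] by blast
  have sub: "\<sigma> ` A \<subseteq> {1..n}"
    using Sym_range[OF \<sigma>] \<open>n \<ge> 1\<close> by (fastforce simp: A_def)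
  have D: "descents n \<sigma> \<subseteq> {1..n - 1}" by (auto simp: descents_def)
  have cA: "card A = n - 1 - card (descents n \<sigma>)"
    unfolding A_def using D by (simp add: card_Diff_subset finite_subset[OF D])
  have cD: "card (descents n \<sigma>) \<le> n - 1" using card_mono[OF _ D] by simp
  have fin: "finite (\<sigma> ` A)" using sub by (rule finite_subset) simp
  have "0 \<notin> \<sigma> ` A" using sub by auto
  then have "card (insert 0 (\<sigma> ` A)) = Suc (card A)"
    using fin by (simp add: card_image permutes_inj_on[OF s])
  moreover have "card ({0..n} - insert 0 (\<sigma> ` A)) = card {0..n} - card (insert 0 (\<sigma> ` A))"
    by (rule card_Diff_subset) (use sub fin in auto)
  ultimately have "card ({0..n} - insert 0 (\<sigma> ` A)) = card (descents n \<sigma>) + 1"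
    using cA cD \<open>n \<ge> 1\<close> by simp
  then show ?thesis unfolding tree_width_def leaves num_descents_def by simp
qed

lemma antisymmetric_tree_width:
  assumes "n \<ge> 1"
  shows "antisymmetric_statistic n (tree_width n)"
  by (rule antisymmetric_statistic_affine[OF antisymmetric_num_descents, where a = 1 and b = 1])
    (simp add: tree_width_eq[OF _ assms])

section \<open>Cosine and Spearman's rho\<close>

lemma sum_reverse_positions:
  fixes f :: "nat \<Rightarrow> int"
  shows "(\<Sum>i=1..n. f (n + 1 - i)) = (\<Sum>i=1..n. f i)"
  by (rule sum.reindex_bij_witness[where i = "\<lambda>i. n + 1 - i" and j = "\<lambda>i. n + 1 - i"]) auto

lemma sum_Sym:
  fixes f :: "nat \<Rightarrow> int"
  assumes "\<sigma> \<in> Sym n"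
  shows "(\<Sum>i=1..n. f (\<sigma> i)) = (\<Sum>i=1..n. f i)"
  by (rule sum.reindex_bij_betw) (use assms in \<open>auto simp: Sym_def intro: permutes_imp_bij\<close>)

text \<open>Complementing replaces the value by \<open>n + 1\<close> minus it; reversing has the
  same effect on the position weight after reindexing. Either way the two cosines add up to
  \<open>n + 1\<close> times the sum of 1 to \<open>n\<close>.\<close>

lemma antisymmetric_cosine: "antisymmetric_statistic n (cosine n)"
proof -
  define c where "c = (int n + 1) * (\<Sum>i=1..n. int i)"
  have "cosine n \<sigma> + cosine n (reverse_map n \<sigma>) = c \<and> cosine n \<sigma> + cosine n (complement_map n \<sigma>) = c"
    if \<sigma>: "\<sigma> \<in> Sym n" for \<sigma>
  proof
    have "cosine n (reverse_map n \<sigma>) = (\<Sum>i=1..n. int i * int (\<sigma> (n + 1 - i)))"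
      unfolding cosine_def by (rule sum.cong) (auto simp: reverse_map_def)
    \<comment> \<open>The weight \<open>i\<close> is rewritten in terms of \<open>n + 1 - i\<close>,
      so that the whole summand depends on \<open>n + 1 - i\<close> only and can be
      reindexed.\<close>
    also have "\<dots> = (\<Sum>i=1..n. (int n + 1 - int (n + 1 - i)) * int (\<sigma> (n + 1 - i)))"
      by (rule sum.cong) auto
    also have "\<dots> = (\<Sum>i=1..n. (int n + 1 - int i) * int (\<sigma> i))"
      by (rule sum_reverse_positions)
    finally have "cosine n \<sigma> + cosine n (reverse_map n \<sigma>) = (\<Sum>i=1..n. (int n + 1) * int (\<sigma> i))"
      unfolding cosine_def by (simp add: sum.distrib[symmetric] algebra_simps)
    then show "cosine n \<sigma> + cosine n (reverse_map n \<sigma>) = c"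
      using sum_Sym[OF \<sigma>, of int] by (simp add: c_def sum_distrib_left[symmetric])
    have "cosine n (complement_map n \<sigma>) = (\<Sum>i=1..n. int i * (int n + 1 - int (\<sigma> i)))"
      unfolding cosine_def
    proof (rule sum.cong)
      fix i assume "i \<in> {1..n}"
      then show "int i * int (complement_map n \<sigma> i) = int i * (int n + 1 - int (\<sigma> i))"
        using Sym_range[OF \<sigma>, of i] by (auto simp: complement_map_def of_nat_diff)
    qed simp
    then show "cosine n \<sigma> + cosine n (complement_map n \<sigma>) = c"
      unfolding cosine_def c_def by (simp add: sum.distrib[symmetric] sum_distrib_left algebra_simps)
  qed
  then show ?thesis unfolding antisymmetric_statistic_def by blast
qed

text \<open>Expanding the square leaves two sums of squares that do not depend on
  \<open>\<sigma>\<close>, and the cross term is -2 times the cosine.\<close>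

lemma antisymmetric_spearman_rho: "antisymmetric_statistic n (spearman_rho n)"
proof (rule antisymmetric_statistic_affine[OF antisymmetric_cosine])
  fix \<sigma> assume \<sigma>: "\<sigma> \<in> Sym n"
  have "spearman_rho n \<sigma> = (\<Sum>i=1..n. (int (\<sigma> i))\<^sup>2) + (\<Sum>i=1..n. (int i)\<^sup>2) - 2 * cosine n \<sigma>"
    by (simp add: spearman_rho_def cosine_def power2_diff sum.distrib sum_subtractf
        sum_distrib_left algebra_simps)
  then show "spearman_rho n \<sigma> = (-2) * cosine n \<sigma> + 2 * (\<Sum>i=1..n. (int i)\<^sup>2)"
    using sum_Sym[OF \<sigma>, of "\<lambda>i. (int i)\<^sup>2"] by simp
qed

section \<open>Odd patterns of length three\<close>

definition position_triples :: "nat \<Rightarrow> (nat \<times> nat \<times> nat) set" where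
  "position_triples n = {(i, j, k). 1 \<le> i \<and> i < j \<and> j < k \<and> k \<le> n}"

text \<open>The exclusive or of the three inversion tests, true when their number is odd. Patterns
  132, 213 and 321 have 1, 1 and 3 inversions; 123, 231 and 312 have 0, 2 and 2.\<close>

definition odd_triple :: "nat \<Rightarrow> nat \<Rightarrow> nat \<Rightarrow> bool" where
  "odd_triple x y z \<longleftrightarrow> (x > y) \<noteq> ((x > z) \<noteq> (y > z))"

definition odd_triples :: "nat \<Rightarrow> (nat \<Rightarrow> nat) \<Rightarrow> (nat \<times> nat \<times> nat) set" where
  "odd_triples n \<sigma> = {(i, j, k) \<in> position_triples n. odd_triple (\<sigma> i) (\<sigma> j) (\<sigma> k)}"

lemma finite_position_triples: "finite (position_triples n)"
  by (rule finite_subset[of _ "{1..n} \<times> {1..n} \<times> {1..n}"]) (auto simp: position_triples_def)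

lemma odd_triples_subset: "odd_triples n \<sigma> \<subseteq> position_triples n"
  by (auto simp: odd_triples_def)

lemma same_relative_order3:
  "same_relative_order [x, y, z] [a, b, c] \<longleftrightarrow> (x < y \<longleftrightarrow> a < b) \<and> (y < x \<longleftrightarrow> b < a)
    \<and> (x < z \<longleftrightarrow> a < c) \<and> (z < x \<longleftrightarrow> c < a) \<and> (y < z \<longleftrightarrow> b < c) \<and> (z < y \<longleftrightarrow> c < b)"
  by (auto simp: same_relative_order_def less_Suc_eq all_conj_distrib numeral_3_eq_3)

lemma odd_pattern_occurrences_eq:
  assumes \<sigma>: "\<sigma> \<in> Sym n"
  shows "num_occurrences3 [1, 3, 2] n \<sigma> + num_occurrences3 [2, 1, 3] n \<sigma>
    + num_occurrences3 [3, 2, 1] n \<sigma> = int (card (odd_triples n \<sigma>))"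
proof -
  define occ where "occ w = {(i, j, k). 1 \<le> i \<and> i < j \<and> j < k \<and> k \<le> n \<and>
     same_relative_order [\<sigma> i, \<sigma> j, \<sigma> k] w}" for w
  have fin: "finite (occ w)" for w
    by (rule finite_subset[OF _ finite_position_triples[of n]])
      (auto simp: occ_def position_triples_def)
  have neq: "\<sigma> i \<noteq> \<sigma> j" if "i < j" for i j using Sym_eq_iff[OF \<sigma>] that by auto
  have iff: "odd_triple x y z \<longleftrightarrow> same_relative_order [x, y, z] [1, 3, 2]
      \<or> same_relative_order [x, y, z] [2, 1, 3] \<or> same_relative_order [x, y, z] [3, 2, 1]"
    if "x \<noteq> y" "y \<noteq> z" "x \<noteq> z" for x y z
    using that unfolding odd_triple_def same_relative_order3 by simp linarith
  have "odd_triples n \<sigma> = occ [1, 3, 2] \<union> occ [2, 1, 3] \<union> occ [3, 2, 1]"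
    unfolding odd_triples_def occ_def position_triples_def
    by (auto simp: iff neq)
  \<comment> \<open>A triple shows only one pattern, so the three counts add without
    overlap.\<close>
  moreover have "occ [1, 3, 2] \<inter> occ [2, 1, 3] = {}"
      "(occ [1, 3, 2] \<union> occ [2, 1, 3]) \<inter> occ [3, 2, 1] = {}"
    by (auto simp: occ_def same_relative_order3)
  ultimately have "card (odd_triples n \<sigma>)
      = card (occ [1, 3, 2]) + card (occ [2, 1, 3]) + card (occ [3, 2, 1])"
    by (simp add: card_Un_disjoint fin)
  then show ?thesis by (simp add: num_occurrences3_def occ_def)
qed

text \<open>For distinct values, exchanging the ends negates all three comparisons, and negating
  three truth values flips their exclusive or.\<close>

lemma odd_triple_swap:
  assumes "x \<noteq> y" "y \<noteq> z" "x \<noteq> z"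
  shows "odd_triple z y x \<longleftrightarrow> \<not> odd_triple x y z"
  using assms unfolding odd_triple_def by linarith

text \<open>Again all three comparisons are negated; the bounds by \<open>m\<close> keep the
  truncated subtraction strictly decreasing.\<close>

lemma odd_triple_complement:
  assumes "x \<noteq> y" "y \<noteq> z" "x \<noteq> z" "x \<le> m" "y \<le> m" "z \<le> m"
  shows "odd_triple (m - x) (m - y) (m - z) \<longleftrightarrow> \<not> odd_triple x y z"
proof -
  have "m - x > m - y \<longleftrightarrow> \<not> x > y" "m - x > m - z \<longleftrightarrow> \<not> x > z" "m - y > m - z \<longleftrightarrow> \<not> y > z"
    using assms by auto
  then show ?thesis unfolding odd_triple_def by blast
qed

lemma odd_triples_complement_map:
  assumes \<sigma>: "\<sigma> \<in> Sym n"
  shows "odd_triples n (complement_map n \<sigma>) = position_triples n - odd_triples n \<sigma>"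
proof -
  have "odd_triple (complement_map n \<sigma> i) (complement_map n \<sigma> j) (complement_map n \<sigma> k)
      \<longleftrightarrow> \<not> odd_triple (\<sigma> i) (\<sigma> j) (\<sigma> k)" if "(i, j, k) \<in> position_triples n" for i j k
  proof -
    have "i \<in> {1..n}" "j \<in> {1..n}" "k \<in> {1..n}" "i \<noteq> j" "j \<noteq> k" "i \<noteq> k"
      using that by (auto simp: position_triples_def)
    then show ?thesis
      using odd_triple_complement[of "\<sigma> i" "\<sigma> j" "\<sigma> k" "n + 1"] Sym_range(2)[OF \<sigma>]
      by (simp add: complement_map_def Sym_eq_iff[OF \<sigma>] le_SucI)
  qed
  then show ?thesis by (auto simp: odd_triples_def)
qed

lemma bij_betw_reflect_odd_triples:
  assumes \<sigma>: "\<sigma> \<in> Sym n"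
  shows "bij_betw (\<lambda>(i, j, k). (n + 1 - k, n + 1 - j, n + 1 - i))
    (odd_triples n (reverse_map n \<sigma>)) (position_triples n - odd_triples n \<sigma>)"
proof -
  have swap: "odd_triple (\<sigma> k) (\<sigma> j) (\<sigma> i) \<longleftrightarrow> \<not> odd_triple (\<sigma> i) (\<sigma> j) (\<sigma> k)"
    if "i \<noteq> j" "j \<noteq> k" "i \<noteq> k" for i j k
    by (rule odd_triple_swap) (use that Sym_eq_iff[OF \<sigma>] in auto)
  have key: "odd_triple (\<sigma> (n + 1 - k)) (\<sigma> (n + 1 - j)) (\<sigma> (n + 1 - i))
      \<longleftrightarrow> \<not> odd_triple (\<sigma> (n + 1 - i)) (\<sigma> (n + 1 - j)) (\<sigma> (n + 1 - k))"
    if "(i, j, k) \<in> position_triples n" for i j k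
    by (rule swap) (use that in \<open>auto simp: position_triples_def\<close>)
  define r where "r = (\<lambda>(i, j, k). (n + 1 - k, n + 1 - j, n + 1 - i))"
  have r_in: "r t \<in> position_triples n" "r (r t) = t" if "t \<in> position_triples n" for t
    using that by (auto simp: r_def position_triples_def)
  \<comment> \<open>The reversed word reads at \<open>t\<close> the values of
    \<open>\<sigma>\<close> at \<open>r t\<close> backwards, which changes the parity of the
    triple.\<close>
  have odd_r: "r t \<in> odd_triples n \<sigma> \<longleftrightarrow> t \<notin> odd_triples n (reverse_map n \<sigma>)"
    if t: "t \<in> position_triples n" for t
  proof -
    obtain i j k where ijk: "t = (i, j, k)" by (cases t) auto
    have "i \<in> {1..n}" "j \<in> {1..n}" "k \<in> {1..n}"
      using t by (auto simp: ijk position_triples_def)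
    then show ?thesis
      using t r_in(1)[OF t] key[of i j k]
      by (simp add: ijk r_def odd_triples_def reverse_map_def)
  qed
  have "bij_betw r (odd_triples n (reverse_map n \<sigma>)) (position_triples n - odd_triples n \<sigma>)"
  proof (rule bij_betw_byWitness[where f' = r])
    show "r ` odd_triples n (reverse_map n \<sigma>) \<subseteq> position_triples n - odd_triples n \<sigma>"
      using r_in(1) odd_r odd_triples_subset by blast
    show "r ` (position_triples n - odd_triples n \<sigma>) \<subseteq> odd_triples n (reverse_map n \<sigma>)"
      using r_in odd_r by (metis DiffE image_subsetI)
  qed (use r_in(2) odd_triples_subset in blast)+
  then show ?thesis unfolding r_def .
qed

text \<open>Each map turns the odd triples into the even ones, up to reflecting positions, so the
  constant is the number of all position triples.\<close>

lemma antisymmetric_odd_patterns: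
  "antisymmetric_statistic n (\<lambda>\<sigma>. num_occurrences3 [1, 3, 2] n \<sigma>
    + num_occurrences3 [2, 1, 3] n \<sigma> + num_occurrences3 [3, 2, 1] n \<sigma>)"
proof (rule antisymmetric_statistic_affine[where a = 1 and b = 0])
  define c where "c = int (card (position_triples n))"
  have diff: "int (card (odd_triples n \<sigma>)) + int (card (position_triples n - odd_triples n \<sigma>)) = c" for \<sigma>
    using card_mono[OF finite_position_triples odd_triples_subset, of n \<sigma>]
    by (simp add: c_def card_Diff_subset odd_triples_subset of_nat_diff
        finite_subset[OF odd_triples_subset finite_position_triples])
  show "antisymmetric_statistic n (\<lambda>\<sigma>. int (card (odd_triples n \<sigma>)))"
    unfolding antisymmetric_statistic_def
    using diff bij_betw_same_card[OF bij_betw_reflect_odd_triples]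
    by (intro exI[of _ c]) (simp add: odd_triples_complement_map)
qed (simp only: odd_pattern_occurrences_eq mult_1 add_0_right)

theorem theorem5p4:
  fixes n :: nat
  assumes "n \<ge> 1"
  shows "\<forall>X \<in> {reverse_map n, complement_map n}.
      homomesic (Sym n) X (num_inversions n)
    \<and> homomesic (Sym n) X (inversion_sum n)
    \<and> homomesic (Sym n) X (num_non_inversions n)
    \<and> homomesic (Sym n) X (non_inversion_sum n)
    \<and> homomesic (Sym n) X (num_inversions_dist_le 3 n)
    \<and> homomesic (Sym n) X (num_inversions_dist_le 2 n)
    \<and> homomesic (Sym n) X (num_even_inversions n)
    \<and> homomesic (Sym n) X (num_odd_inversions n)
    \<and> homomesic (Sym n) X (std_bialternating_inversion_number n)
    \<and> homomesic (Sym n) X (num_descents n)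
    \<and> homomesic (Sym n) X (num_ascents n)
    \<and> homomesic (Sym n) X (num_runs n)
    \<and> homomesic (Sym n) X (num_cyclic_descents n)
    \<and> homomesic (Sym n) X (num_descents_dist2 n)
    \<and> homomesic (Sym n) X (num_ascents_dist2 n)
    \<and> homomesic (Sym n) X (num_strict_3_descents n)
    \<and> homomesic (Sym n) X (tree_width n)
    \<and> homomesic (Sym n) X (cosine n)
    \<and> homomesic (Sym n) X (num_recoils n)
    \<and> homomesic (Sym n) X (\<lambda>\<sigma>. num_occurrences3 [1, 3, 2] n \<sigma>
          + num_occurrences3 [2, 1, 3] n \<sigma> + num_occurrences3 [3, 2, 1] n \<sigma>)
    \<and> homomesic (Sym n) X (\<lambda>\<sigma>. num_descents n \<sigma> + num_recoils n \<sigma>)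
    \<and> homomesic (Sym n) X (spearman_rho n)"
  by (intro ballI conjI; rule antisymmetric_statistic_imp_homomesic; (assumption |
      rule antisymmetric_num_inversions antisymmetric_inversion_sum
        antisymmetric_num_non_inversions antisymmetric_non_inversion_sum
        antisymmetric_num_inversions_dist_le antisymmetric_num_even_inversions
        antisymmetric_num_odd_inversions antisymmetric_std_bialternating
        antisymmetric_num_descents antisymmetric_num_ascents antisymmetric_num_runs[OF assms]
        antisymmetric_num_cyclic_descents[OF assms] antisymmetric_num_descents_dist2
        antisymmetric_num_ascents_dist2 antisymmetric_num_strict_3_descents
        antisymmetric_tree_width[OF assms] antisymmetric_cosine antisymmetric_num_recoils
        antisymmetric_odd_patterns
        antisymmetric_statistic_add[OF antisymmetric_num_descents antisymmetric_num_recoils]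
        antisymmetric_spearman_rho))

end
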